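(* Let $1<p<\infty$, let $B$ be a finite Blaschke product (for the upper half-plane) and let $g\in L_\infty$. If $\phi_+$ is a maximal function for $\ker T_g$, then $B\phi_+$ is a maximal function for $\ker T_{\overline{B}g}$.
   Context: $H_p^\pm=H^p(\mathbb{C}^\pm)$ are the Hardy spaces of the upper/lower half-plane, identified via boundary values with closed subspaces of $L_p=L^p(\mathbb{R})$; $L_\infty=L^\infty(\mathbb{R})$. $P^+:L_p\to H_p^+$ is the projection with kernel $H_p^-$; for $g\in L_\infty$ the Toeplitz operator is $T_gf_+=P^+(gf_+)$ on $H_p^+$, so $\ker T_g=\{f_+\in H_p^+: gf_+\in H_p^-\}$. A T-kernel is a set of the form $\ker T_g$ with $g\in L_\infty$. For $\phi_+\in H_p^+\setminus\{0\}$, $\mathcal{K}_{\min}(\phi_+)$ denotes the smallest T-kernel containing $\phi_+$: it is a T-kernel containing $\phi_+$, and for any $g\in L_\infty$, $\phi_+\in\ker T_g$ implies $\mathcal{K}_{\min}(\phi_+)\subset\ker T_g$. It is known to exist, and if $\phi_+=I_+O_+$ is an inner-outer factorisation then $\mathcal{K}_{\min}(\phi_+)=\ker T_{\overline{I}_+\overline{O}_+/O_+}$. If $K=\mathcal{K}_{\min}(\phi_+)$, then $\phi_+$ is called a maximal function for $K$. *)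

theory Defs
  imports "HOL-Analysis.Analysis"
begin

text \<open>
  Elements of the Lebesgue spaces are represented by measurable functions rather than by
  equivalence classes.  All sets of functions below are saturated under equality almost everywhere,
  so equality and inclusion of these sets are equality and inclusion of the sets of classes,
  and ``\<open>f \<noteq> 0\<close>'' reads ``not almost everywhere zero''.
\<close>

definition Lp_space :: "real \<Rightarrow> (real \<Rightarrow> complex) set" where
  "Lp_space p = {f \<in> borel_measurable lebesgue. integrable lebesgue (\<lambda>x. norm (f x) powr p)}"

definition Linf_space :: "(real \<Rightarrow> complex) set" where
  "Linf_space = {g \<in> borel_measurable lebesgue. \<exists>C. AE x in lebesgue. norm (g x) \<le> C}"

definition upper_half_plane :: "complex set" where
  "upper_half_plane = {z. Im z > 0}"

definition lower_half_plane :: "complex set" where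
  "lower_half_plane = {z. Im z < 0}"

definition holo_hardy_plus :: "real \<Rightarrow> (complex \<Rightarrow> complex) set" where
  "holo_hardy_plus p = {F. F holomorphic_on upper_half_plane \<and>
     (SUP y\<in>{0<..}. \<integral>\<^sup>+x. ennreal (norm (F (Complex x y)) powr p) \<partial>lebesgue) < \<infinity>}"

definition holo_hardy_minus :: "real \<Rightarrow> (complex \<Rightarrow> complex) set" where
  "holo_hardy_minus p = {F. F holomorphic_on lower_half_plane \<and>
     (SUP y\<in>{..<0}. \<integral>\<^sup>+x. ennreal (norm (F (Complex x y)) powr p) \<partial>lebesgue) < \<infinity>}"

text \<open>Nontangential limit at the real point \<open>x\<close> from the half-plane \<open>U\<close>.\<close>

definition nontangential_limit ::
    "complex set \<Rightarrow> (complex \<Rightarrow> complex) \<Rightarrow> real \<Rightarrow> complex \<Rightarrow> bool" where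
  "nontangential_limit U F x l \<longleftrightarrow>
     (\<forall>a>0. (F \<longlongrightarrow> l) (at (complex_of_real x) within {z \<in> U. \<bar>Re z - x\<bar> < a * \<bar>Im z\<bar>}))"

definition hardy_plus :: "real \<Rightarrow> (real \<Rightarrow> complex) set" where
  "hardy_plus p = {f \<in> Lp_space p. \<exists>F \<in> holo_hardy_plus p.
     AE x in lebesgue. nontangential_limit upper_half_plane F x (f x)}"

definition hardy_minus :: "real \<Rightarrow> (real \<Rightarrow> complex) set" where
  "hardy_minus p = {f \<in> Lp_space p. \<exists>F \<in> holo_hardy_minus p.
     AE x in lebesgue. nontangential_limit lower_half_plane F x (f x)}"

text \<open>
  The projection \<open>P\<^sup>+\<close> of \<open>L\<^sub>p\<close> onto the range \<open>hardy_plus p\<close> with kernel \<open>hardy_minus p\<close>, and the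
  Toeplitz operators, are given by their graphs (\<open>u\<close> is the value, unique almost everywhere).
  For \<open>1 < p < \<infinity>\<close> these are graphs of everywhere defined operators, since then \<open>L\<^sub>p\<close> is the direct
  sum of the two Hardy spaces (M. Riesz).
\<close>

definition riesz_projection :: "real \<Rightarrow> (real \<Rightarrow> complex) \<Rightarrow> (real \<Rightarrow> complex) \<Rightarrow> bool" where
  "riesz_projection p h u \<longleftrightarrow>
     h \<in> Lp_space p \<and> u \<in> hardy_plus p \<and> (\<lambda>x. h x - u x) \<in> hardy_minus p"

definition toeplitz ::
    "real \<Rightarrow> (real \<Rightarrow> complex) \<Rightarrow> (real \<Rightarrow> complex) \<Rightarrow> (real \<Rightarrow> complex) \<Rightarrow> bool" where
  "toeplitz p g f u \<longleftrightarrow> f \<in> hardy_plus p \<and> riesz_projection p (\<lambda>x. g x * f x) u"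

definition toeplitz_kernel :: "real \<Rightarrow> (real \<Rightarrow> complex) \<Rightarrow> (real \<Rightarrow> complex) set" where
  "toeplitz_kernel p g = {f. toeplitz p g f (\<lambda>x. 0)}"

definition T_kernel :: "real \<Rightarrow> (real \<Rightarrow> complex) set \<Rightarrow> bool" where
  "T_kernel p K \<longleftrightarrow> (\<exists>g \<in> Linf_space. K = toeplitz_kernel p g)"

definition is_minimal_kernel :: "real \<Rightarrow> (real \<Rightarrow> complex) \<Rightarrow> (real \<Rightarrow> complex) set \<Rightarrow> bool" where
  "is_minimal_kernel p \<phi> K \<longleftrightarrow> T_kernel p K \<and> \<phi> \<in> K \<and>
     (\<forall>g \<in> Linf_space. \<phi> \<in> toeplitz_kernel p g \<longrightarrow> K \<subseteq> toeplitz_kernel p g)"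

definition maximal_function :: "real \<Rightarrow> (real \<Rightarrow> complex) \<Rightarrow> (real \<Rightarrow> complex) set \<Rightarrow> bool" where
  "maximal_function p \<phi> K \<longleftrightarrow>
     \<phi> \<in> hardy_plus p \<and> \<not> (AE x in lebesgue. \<phi> x = 0) \<and> is_minimal_kernel p \<phi> K"

text \<open>
  The formula is only imposed on the closed upper half-plane, away from the poles \<open>cnj a\<close>;
  zeros may be repeated, and unimodular constants are the products of degree 0.
\<close>

definition finite_blaschke_product :: "(complex \<Rightarrow> complex) \<Rightarrow> bool" where
  "finite_blaschke_product B \<longleftrightarrow>
     (\<exists>c as. norm c = 1 \<and> (\<forall>a \<in> set as. Im a > 0) \<and>
        (\<forall>z. Im z \<ge> 0 \<longrightarrow> B z = c * (\<Prod>a\<leftarrow>as. (z - a) / (z - cnj a))))"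

lemma zero_in_hardy_plus: "(\<lambda>x. 0) \<in> hardy_plus p"
proof -
  have "(\<lambda>z. 0) \<in> holo_hardy_plus p"
    by (simp add: holo_hardy_plus_def)
  moreover have "nontangential_limit upper_half_plane (\<lambda>z. 0) x 0" for x
    by (simp add: nontangential_limit_def)
  moreover have "(\<lambda>x. 0) \<in> Lp_space p"
    by (simp add: Lp_space_def)
  ultimately show ?thesis
    unfolding hardy_plus_def by fastforce
qed

lemma toeplitz_kernel_eq:
  "toeplitz_kernel p g = {f \<in> hardy_plus p. (\<lambda>x. g x * f x) \<in> hardy_minus p}"
  by (auto simp: toeplitz_kernel_def toeplitz_def riesz_projection_def zero_in_hardy_plus
      hardy_minus_def)

lemma is_minimal_kernel_unique:
  "is_minimal_kernel p \<phi> K \<Longrightarrow> is_minimal_kernel p \<phi> K' \<Longrightarrow> K = K'"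
  unfolding is_minimal_kernel_def T_kernel_def by (metis subset_antisym)

lemma Lp_space_cong_AE:
  assumes "f \<in> Lp_space p" "AE x in lebesgue. f x = f' x"
  shows "f' \<in> Lp_space p"
proof -
  have f [measurable]: "f \<in> borel_measurable lebesgue"
    and int: "integrable lebesgue (\<lambda>x. norm (f x) powr p)"
    using assms(1) by (auto simp: Lp_space_def)
  have f' [measurable]: "f' \<in> borel_measurable lebesgue"
  proof (rule measurableI)
    fix A :: "complex set" assume A: "A \<in> sets borel"
    have "f -` A \<inter> space lebesgue \<in> sets lebesgue"
      using A f by (rule measurable_sets[rotated])
    then show "f' -` A \<inter> space lebesgue \<in> sets lebesgue"
    proof (rule completion.in_sets_AE[rotated])
      show "AE x in lebesgue. x \<in> f -` A \<inter> space lebesgue \<longleftrightarrow> x \<in> f' -` A \<inter> space lebesgue"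
        using assms(2) by eventually_elim simp
    qed simp
  qed auto
  have "integrable lebesgue (\<lambda>x. norm (f' x) powr p)"
  proof (rule integrable_cong_AE_imp[OF int])
    show "(\<lambda>x. norm (f' x) powr p) \<in> borel_measurable lebesgue"
      by measurable
    show "AE x in lebesgue. norm (f x) powr p = norm (f' x) powr p"
      using assms(2) by eventually_elim simp
  qed
  with f' show ?thesis
    by (simp add: Lp_space_def)
qed

lemma hardy_plus_cong_AE:
  assumes "f \<in> hardy_plus p" "AE x in lebesgue. f x = f' x"
  shows "f' \<in> hardy_plus p"
proof -
  obtain F where F: "F \<in> holo_hardy_plus p"
    and lim: "AE x in lebesgue. nontangential_limit upper_half_plane F x (f x)"
    using assms(1) by (auto simp: hardy_plus_def)
  have "AE x in lebesgue. nontangential_limit upper_half_plane F x (f' x)"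
    using lim assms(2) by eventually_elim simp
  with F Lp_space_cong_AE[OF _ assms(2)] assms(1) show ?thesis
    by (auto simp: hardy_plus_def)
qed

lemma hardy_minus_cong_AE:
  assumes "f \<in> hardy_minus p" "AE x in lebesgue. f x = f' x"
  shows "f' \<in> hardy_minus p"
proof -
  obtain F where F: "F \<in> holo_hardy_minus p"
    and lim: "AE x in lebesgue. nontangential_limit lower_half_plane F x (f x)"
    using assms(1) by (auto simp: hardy_minus_def)
  have "AE x in lebesgue. nontangential_limit lower_half_plane F x (f' x)"
    using lim assms(2) by eventually_elim simp
  with F Lp_space_cong_AE[OF _ assms(2)] assms(1) show ?thesis
    by (auto simp: hardy_minus_def)
qed

end

theory Submission
  imports Defs "HOL-Complex_Analysis.Conformal_Mappings"
begin

text \<open>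
  The multiplier \<open>B\<close> is peeled off one zero at a time, so let \<open>b\<close> be the Blaschke factor with zero
  \<open>a\<close> in the upper half-plane.  On the real line \<open>cnj b = 1 / b\<close>, and \<open>1 / b\<close> is the factor
  with parameter \<open>cnj a\<close>, which is holomorphic and bounded by 1 in the lower half-plane.  Hence
  multiplication by \<open>cnj b\<close> preserves \<open>hardy_minus p\<close>, and so
  \<open>ker T\<^bsub>h\<^esub> \<subseteq> ker T\<^bsub>cnj b h\<^esub>\<close> for every symbol \<open>h\<close>.

  Let \<open>\<phi>\<close> be maximal for \<open>ker T\<^bsub>g\<^esub>\<close>.  Then \<open>b \<phi>\<close> lies in \<open>ker T\<^bsub>cnj b g\<^esub>\<close> because
  \<open>cnj b g b \<phi> = g \<phi>\<close>.  For minimality, suppose \<open>b \<phi> \<in> ker T\<^bsub>h\<^esub>\<close>, that is,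
  \<open>\<phi> \<in> ker T\<^bsub>b h\<^esub>\<close>.  Maximality of \<open>\<phi>\<close> yields \<open>ker T\<^bsub>g\<^esub> \<subseteq> ker T\<^bsub>b h\<^esub>\<close>.  Passing from \<open>g\<close> to
  \<open>cnj b g\<close> enlarges the kernel by at most one dimension: an element of \<open>ker T\<^bsub>cnj b g\<^esub>\<close> whose
  extension vanishes at \<open>a\<close> has the form \<open>b f\<close> with \<open>f \<in> ker T\<^bsub>g\<^esub>\<close>, and then
  \<open>h b f \<in> hardy_minus p\<close> says that \<open>b f \<in> ker T\<^bsub>h\<^esub>\<close>.  To account for the remaining dimension it
  suffices to find one \<open>\<psi> \<in> ker T\<^bsub>cnj b g\<^esub> \<inter> ker T\<^bsub>h\<^esub>\<close> that does not vanish at \<open>a\<close>, since any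
  element of \<open>ker T\<^bsub>cnj b g\<^esub>\<close> minus a multiple of \<open>\<psi>\<close> then vanishes at \<open>a\<close>.  Such a \<open>\<psi>\<close> is
  \<open>\<phi> / b\<^sup>n\<close>, with \<open>n\<close> the order of the zero of \<open>\<phi>\<close> at \<open>a\<close>
  (\<open>toeplitz_kernel_nonvanishing_element\<close>): it lies in \<open>ker T\<^bsub>g\<^esub>\<close>, hence in \<open>ker T\<^bsub>cnj b g\<^esub>\<close> and in
  \<open>ker T\<^bsub>b h\<^esub> \<subseteq> ker T\<^bsub>cnj b b h\<^esub> = ker T\<^bsub>h\<^esub>\<close>.

  The analytic input is that dividing a Hardy function by \<open>b\<^sup>n\<close> stays in the Hardy space when the
  quotient is holomorphic (\<open>hardy_extension_divide_blaschke_power\<close>): \<open>1 / b\<close> is bounded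
  outside a disc around \<open>a\<close>, and on that disc the quotient is bounded by compactness.
\<close>

section \<open>Holomorphic extensions with bounded means\<close>

text \<open>
  The set \<open>Y\<close> consists of the heights of the horizontal lines on which \<open>F\<close> lives.  The choices
  \<open>{0<..}\<close> and \<open>{..<0}\<close> give both Hardy spaces, so that each closure property is proved once.
  The extension \<open>F\<close> is an argument because its zeros have to be tracked.
\<close>

definition hardy_extension ::
    "real set \<Rightarrow> real \<Rightarrow> (complex \<Rightarrow> complex) \<Rightarrow> (real \<Rightarrow> complex) \<Rightarrow> bool" where
  "hardy_extension Y p F f \<longleftrightarrow> f \<in> Lp_space p \<and> F holomorphic_on {z. Im z \<in> Y} \<and>
     (SUP y\<in>Y. \<integral>\<^sup>+x. ennreal (norm (F (Complex x y)) powr p) \<partial>lebesgue) < \<infinity> \<and>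
     (AE x in lebesgue. nontangential_limit {z. Im z \<in> Y} F x (f x))"

lemma hardy_plus_iff: "f \<in> hardy_plus p \<longleftrightarrow> (\<exists>F. hardy_extension {0<..} p F f)"
  by (auto simp: hardy_plus_def holo_hardy_plus_def hardy_extension_def upper_half_plane_def)

lemma hardy_minus_iff: "f \<in> hardy_minus p \<longleftrightarrow> (\<exists>F. hardy_extension {..<0} p F f)"
  by (auto simp: hardy_minus_def holo_hardy_minus_def hardy_extension_def lower_half_plane_def)

lemma open_upper_half_plane: "open {z. Im z > 0}"
  using open_halfspace_Im_gt[of 0] by simp

lemma norm_on_line_measurable:
  assumes "F holomorphic_on {z. Im z \<in> Y}" "y \<in> Y"
  shows "(\<lambda>x. ennreal (norm (F (Complex x y)) powr p)) \<in> borel_measurable lebesgue"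
proof -
  have "continuous_on UNIV (\<lambda>x. F (Complex x y))"
    by (rule continuous_on_compose2[OF holomorphic_on_imp_continuous_on[OF assms(1)]])
       (use assms(2) in \<open>auto simp: Complex_eq intro!: continuous_intros\<close>)
  then have "(\<lambda>x. F (Complex x y)) \<in> borel_measurable borel"
    by (rule borel_measurable_continuous_onI)
  then have [measurable]: "(\<lambda>x. F (Complex x y)) \<in> borel_measurable lebesgue"
    by (intro measurable_completion) simp
  show ?thesis by measurable
qed

lemma means_bounded:
  assumes "hardy_extension Y p F f"
  obtains S where "S < \<infinity>"
    "\<And>y. y \<in> Y \<Longrightarrow> (\<integral>\<^sup>+x. ennreal (norm (F (Complex x y)) powr p) \<partial>lebesgue) \<le> S"
  using assms unfolding hardy_extension_def by (meson SUP_upper)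

text \<open>
  A pointwise bound by \<open>F\<close> off a compact set suffices: on the compact set \<open>G\<close> is bounded, and every
  horizontal line meets the set inside one fixed bounded interval, so the contribution of that set
  to the means is bounded uniformly in the height.
\<close>

lemma means_bounded_off_compact:
  assumes "hardy_extension Y p F f" "0 < p" "G holomorphic_on {z. Im z \<in> Y}"
    and K: "compact K" "K \<subseteq> {z. Im z \<in> Y}" and "0 \<le> C"
    and bound: "\<And>z. \<lbrakk>Im z \<in> Y; z \<notin> K\<rbrakk> \<Longrightarrow> norm (G z) \<le> C * norm (F z)"
  shows "(SUP y\<in>Y. \<integral>\<^sup>+x. ennreal (norm (G (Complex x y)) powr p) \<partial>lebesgue) < \<infinity>"
proof -
  obtain S where S: "S < \<infinity>"
    "\<And>y. y \<in> Y \<Longrightarrow> (\<integral>\<^sup>+x. ennreal (norm (F (Complex x y)) powr p) \<partial>lebesgue) \<le> S"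
    using means_bounded[OF assms(1)] by blast
  have F: "F holomorphic_on {z. Im z \<in> Y}"
    using assms(1) by (simp add: hardy_extension_def)
  have "compact (G ` K)"
    using K assms(3) by (meson compact_continuous_image continuous_on_subset
        holomorphic_on_imp_continuous_on)
  then obtain D where D: "D > 0" "\<And>z. z \<in> K \<Longrightarrow> norm (G z) \<le> D"
    by (metis bounded_pos compact_imp_bounded image_eqI)
  obtain R where R: "R > 0" "\<And>z. z \<in> K \<Longrightarrow> norm z \<le> R"
    using K(1) by (metis bounded_pos compact_imp_bounded)
  have R_meas: "{-R..R} \<in> sets lebesgue"
    by simp
  let ?T = "ennreal (C powr p) * S + ennreal (D powr p) * emeasure lebesgue {-R..R}"
  have "(\<integral>\<^sup>+x. ennreal (norm (G (Complex x y)) powr p) \<partial>lebesgue) \<le> ?T" if y: "y \<in> Y" for y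
  proof -
    have pw: "ennreal (norm (G (Complex x y)) powr p) \<le>
        ennreal (C powr p) * ennreal (norm (F (Complex x y)) powr p) +
        ennreal (D powr p) * indicator {-R..R} x" for x
    proof (cases "Complex x y \<in> K")
      case True
      then have "\<bar>x\<bar> \<le> R"
        using R(2)[OF True] abs_Re_le_cmod[of "Complex x y"] by simp
      moreover have "norm (G (Complex x y)) powr p \<le> D powr p"
        using D(2)[OF True] assms(2) by (intro powr_mono2) auto
      ultimately show ?thesis
        by (auto simp: indicator_def intro!: add_increasing ennreal_leI)
    next
      case False
      then have "norm (G (Complex x y)) powr p \<le> (C * norm (F (Complex x y))) powr p"
        using bound[of "Complex x y"] y assms(2) by (intro powr_mono2) auto
      then show ?thesis
        using assms(6) by (auto simp: powr_mult ennreal_mult[symmetric]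
            intro!: add_increasing2 ennreal_leI)
    qed
    have "(\<integral>\<^sup>+x. ennreal (norm (G (Complex x y)) powr p) \<partial>lebesgue) \<le>
        (\<integral>\<^sup>+x. ennreal (C powr p) * ennreal (norm (F (Complex x y)) powr p) +
        ennreal (D powr p) * indicator {-R..R} x \<partial>lebesgue)"
      by (rule nn_integral_mono) (rule pw)
    also have "\<dots> = ennreal (C powr p) * (\<integral>\<^sup>+x. ennreal (norm (F (Complex x y)) powr p) \<partial>lebesgue)
        + ennreal (D powr p) * emeasure lebesgue {-R..R}"
    proof -
      show ?thesis
        by (subst nn_integral_add)
           (simp_all only: borel_measurable_times_ennreal borel_measurable_const
             nn_integral_indicator borel_measurable_indicator nn_integral_cmult norm_on_line_measurable[OF F y]
             nn_integral_cmult_indicator R_meas)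
    qed
    also have "\<dots> \<le> ?T"
      using S(2)[OF y] by (intro add_mono mult_left_mono) auto
    finally show ?thesis .
  qed
  then have "(SUP y\<in>Y. \<integral>\<^sup>+x. ennreal (norm (G (Complex x y)) powr p) \<partial>lebesgue) \<le> ?T"
    by (rule SUP_least)
  also have "\<dots> < \<infinity>"
    using S(1) R(1) by (auto simp: ennreal_mult_less_top)
  finally show ?thesis .
qed

lemma measurable_of_isCont_on_reals:
  fixes M :: "complex \<Rightarrow> complex"
  assumes "\<And>x. isCont M (complex_of_real x)"
  shows "(\<lambda>x. M (complex_of_real x)) \<in> borel_measurable lebesgue"
proof -
  have "isCont (\<lambda>x. M (complex_of_real x)) x" for x
    by (rule isCont_o2[where f = complex_of_real and g = M, OF _ assms]) (rule isCont_of_real, rule continuous_ident)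
  then have "(\<lambda>x. M (complex_of_real x)) \<in> borel_measurable borel"
    by (intro borel_measurable_continuous_onI continuous_at_imp_continuous_on) simp
  then show ?thesis
    by (intro measurable_completion) simp
qed

text \<open>
  The multiplier \<open>M\<close> may have poles inside the compact set \<open>K\<close>, provided that \<open>G\<close> fills in the
  product \<open>M F\<close> holomorphically.  With \<open>K\<close> empty this is multiplication by a bounded function;
  with \<open>K\<close> a disc around a zero of \<open>F\<close> it allows division by a Blaschke factor.
\<close>

lemma hardy_extension_mult:
  assumes "hardy_extension Y p F f" "0 < p"
    and G: "G holomorphic_on {z. Im z \<in> Y}"
    and K: "compact K" "K \<subseteq> {z. Im z \<in> Y}" "0 \<notin> Y"
    and eq: "\<And>z. \<lbrakk>Im z \<in> Y; z \<notin> K\<rbrakk> \<Longrightarrow> G z = M z * F z"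
    and M: "\<And>z. \<lbrakk>Im z \<in> Y; z \<notin> K\<rbrakk> \<Longrightarrow> norm (M z) \<le> C"
    and real: "\<And>x. norm (M (complex_of_real x)) \<le> C" "\<And>x. isCont M (complex_of_real x)"
  shows "hardy_extension Y p G (\<lambda>x. M (complex_of_real x) * f x)"
proof -
  have C: "0 \<le> C"
    using real(1)[of 0] norm_ge_zero order_trans by blast
  have M_meas [measurable]: "(\<lambda>x. M (complex_of_real x)) \<in> borel_measurable lebesgue"
    using measurable_of_isCont_on_reals real(2) by blast
  have f_meas [measurable]: "f \<in> borel_measurable lebesgue"
    and f_int: "integrable lebesgue (\<lambda>x. norm (f x) powr p)"
    using assms(1) by (auto simp: hardy_extension_def Lp_space_def)
  have "integrable lebesgue (\<lambda>x. norm (M (complex_of_real x) * f x) powr p)"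
  proof (rule Bochner_Integration.integrable_bound)
    show "integrable lebesgue (\<lambda>x. C powr p * norm (f x) powr p)"
      using f_int by simp
    show "AE x in lebesgue. norm (norm (M (complex_of_real x) * f x) powr p)
        \<le> norm (C powr p * norm (f x) powr p)"
    proof (intro AE_I2)
      fix x
      have "norm (M (complex_of_real x) * f x) powr p \<le> (C * norm (f x)) powr p"
        using assms(2) real(1)[of x] C
        by (intro powr_mono2) (auto simp: norm_mult mult_right_mono)
      then show "norm (norm (M (complex_of_real x) * f x) powr p)
        \<le> norm (C powr p * norm (f x) powr p)"
        using C by (simp add: powr_mult)
    qed
  qed measurable
  then have "(\<lambda>x. M (complex_of_real x) * f x) \<in> Lp_space p"
    by (simp add: Lp_space_def)
  moreover have "(SUP y\<in>Y. \<integral>\<^sup>+x. ennreal (norm (G (Complex x y)) powr p) \<partial>lebesgue) < \<infinity>"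
    using eq M by (intro means_bounded_off_compact[OF assms(1,2) G K(1,2) C])
      (simp add: norm_mult mult_right_mono)
  moreover have "nontangential_limit {z. Im z \<in> Y} G x (M (complex_of_real x) * f x)"
    if "nontangential_limit {z. Im z \<in> Y} F x (f x)" for x
    unfolding nontangential_limit_def
  proof (intro allI impI)
    fix \<alpha> :: real assume "\<alpha> > 0"
    let ?A = "at (complex_of_real x) within {z \<in> {z. Im z \<in> Y}. \<bar>Re z - x\<bar> < \<alpha> * \<bar>Im z\<bar>}"
    \<comment> \<open>The set \<open>K\<close> is closed and misses the real line, so near \<open>x\<close> the product formula holds.\<close>
    have "complex_of_real x \<in> - K" "open (- K)"
      using K by (auto intro: compact_imp_closed)
    then have "\<forall>\<^sub>F z in ?A. z \<in> - K"
      by (auto intro: eventually_at_topological[THEN iffD2])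
    moreover have "\<forall>\<^sub>F z in ?A. Im z \<in> Y"
      by (auto simp: eventually_at_filter)
    ultimately have ev: "\<forall>\<^sub>F z in ?A. M z * F z = G z"
      by eventually_elim (simp add: eq)
    have "(M \<longlongrightarrow> M (complex_of_real x)) ?A"
      using real(2)[of x] by (auto simp: isCont_def intro: tendsto_within_subset)
    moreover have "(F \<longlongrightarrow> f x) ?A"
      using that \<open>\<alpha> > 0\<close> by (simp add: nontangential_limit_def)
    ultimately show "(G \<longlongrightarrow> M (complex_of_real x) * f x) ?A"
      using tendsto_cong[OF ev] tendsto_mult by blast
  qed
  ultimately show ?thesis
    using assms(1) G unfolding hardy_extension_def by auto
qed

lemma powr_norm_add_le:
  fixes u v :: complex
  assumes "0 < p"
  shows "norm (u + v) powr p \<le> 2 powr p * norm u powr p + 2 powr p * norm v powr p"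
proof -
  have "norm (u + v) powr p \<le> (2 * max (norm u) (norm v)) powr p"
    using assms norm_triangle_ineq[of u v] by (intro powr_mono2) auto
  also have "\<dots> = 2 powr p * max (norm u) (norm v) powr p"
    by (simp add: powr_mult)
  also have "\<dots> \<le> 2 powr p * (norm u powr p + norm v powr p)"
    by (intro mult_left_mono) (auto simp: max_def)
  finally show ?thesis by (simp add: algebra_simps)
qed

lemma hardy_extension_add:
  assumes "hardy_extension Y p F f" "hardy_extension Y p G g" "0 < p"
  shows "hardy_extension Y p (\<lambda>z. F z + G z) (\<lambda>x. f x + g x)"
proof -
  have meas [measurable]: "f \<in> borel_measurable lebesgue" "g \<in> borel_measurable lebesgue"
    and int: "integrable lebesgue (\<lambda>x. norm (f x) powr p)"
      "integrable lebesgue (\<lambda>x. norm (g x) powr p)"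
    and holo: "F holomorphic_on {z. Im z \<in> Y}" "G holomorphic_on {z. Im z \<in> Y}"
    using assms(1,2) by (auto simp: hardy_extension_def Lp_space_def)
  have "integrable lebesgue (\<lambda>x. norm (f x + g x) powr p)"
  proof (rule Bochner_Integration.integrable_bound)
    show "integrable lebesgue (\<lambda>x. 2 powr p * norm (f x) powr p + 2 powr p * norm (g x) powr p)"
      using int by simp
    show "AE x in lebesgue. norm (norm (f x + g x) powr p) \<le>
        norm (2 powr p * norm (f x) powr p + 2 powr p * norm (g x) powr p)"
      using powr_norm_add_le[OF assms(3)] by (auto intro!: AE_I2)
  qed measurable
  then have "(\<lambda>x. f x + g x) \<in> Lp_space p"
    by (simp add: Lp_space_def)
  moreover obtain S where S: "S < \<infinity>"
    "\<And>y. y \<in> Y \<Longrightarrow> (\<integral>\<^sup>+x. ennreal (norm (F (Complex x y)) powr p) \<partial>lebesgue) \<le> S"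
    using means_bounded[OF assms(1)] by blast
  obtain T where T: "T < \<infinity>"
    "\<And>y. y \<in> Y \<Longrightarrow> (\<integral>\<^sup>+x. ennreal (norm (G (Complex x y)) powr p) \<partial>lebesgue) \<le> T"
    using means_bounded[OF assms(2)] by blast
  have "(\<integral>\<^sup>+x. ennreal (norm (F (Complex x y) + G (Complex x y)) powr p) \<partial>lebesgue)
      \<le> ennreal (2 powr p) * S + ennreal (2 powr p) * T" if y: "y \<in> Y" for y
  proof -
    have "(\<integral>\<^sup>+x. ennreal (norm (F (Complex x y) + G (Complex x y)) powr p) \<partial>lebesgue) \<le>
        (\<integral>\<^sup>+x. ennreal (2 powr p) * ennreal (norm (F (Complex x y)) powr p) +
           ennreal (2 powr p) * ennreal (norm (G (Complex x y)) powr p) \<partial>lebesgue)"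
      using powr_norm_add_le[OF assms(3)]
      by (intro nn_integral_mono) (simp add: ennreal_mult[symmetric] ennreal_plus[symmetric]
          ennreal_leI del: ennreal_plus)
    also have "\<dots> = ennreal (2 powr p) * (\<integral>\<^sup>+x. ennreal (norm (F (Complex x y)) powr p) \<partial>lebesgue)
       + ennreal (2 powr p) * (\<integral>\<^sup>+x. ennreal (norm (G (Complex x y)) powr p) \<partial>lebesgue)"
      by (subst nn_integral_add)
         (simp_all only: nn_integral_cmult borel_measurable_times_ennreal borel_measurable_const
           norm_on_line_measurable[OF holo(1) y] norm_on_line_measurable[OF holo(2) y])
    also have "\<dots> \<le> ennreal (2 powr p) * S + ennreal (2 powr p) * T"
      using S(2)[OF y] T(2)[OF y] by (intro add_mono mult_left_mono) auto
    finally show ?thesis .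
  qed
  then have "(SUP y\<in>Y. \<integral>\<^sup>+x. ennreal (norm (F (Complex x y) + G (Complex x y)) powr p) \<partial>lebesgue)
      \<le> ennreal (2 powr p) * S + ennreal (2 powr p) * T"
    by (rule SUP_least)
  then have "(SUP y\<in>Y. \<integral>\<^sup>+x. ennreal (norm (F (Complex x y) + G (Complex x y)) powr p) \<partial>lebesgue)
      < \<infinity>"
    using S(1) T(1) by (auto simp: ennreal_mult_less_top elim!: order_le_less_trans)
  moreover have "AE x in lebesgue. nontangential_limit {z. Im z \<in> Y} (\<lambda>z. F z + G z) x (f x + g x)"
  proof -
    have "AE x in lebesgue. nontangential_limit {z. Im z \<in> Y} F x (f x)"
      "AE x in lebesgue. nontangential_limit {z. Im z \<in> Y} G x (g x)"
      using assms(1,2) by (auto simp: hardy_extension_def)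
    then show ?thesis
      by eventually_elim (auto simp: nontangential_limit_def intro: tendsto_add)
  qed
  ultimately show ?thesis
    using holo by (simp add: hardy_extension_def holomorphic_on_add)
qed

lemma hardy_extension_cmult:
  assumes "hardy_extension Y p F f" "0 < p" "0 \<notin> Y"
  shows "hardy_extension Y p (\<lambda>z. c * F z) (\<lambda>x. c * f x)"
proof (rule hardy_extension_mult[OF assms(1,2), where K = "{}" and M = "\<lambda>_. c" and C = "norm c"])
  show "(\<lambda>z. c * F z) holomorphic_on {z. Im z \<in> Y}"
    using assms(1) by (intro holomorphic_intros) (simp add: hardy_extension_def)
qed (use assms(3) in simp_all)

text \<open>
  The vertical line through \<open>x\<close> lies in every nontangential approach region, so the boundary
  value at \<open>x\<close> is recovered along it as a limit of zeros.  This turns a nonzero boundary function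
  into a nonzero holomorphic one.
\<close>

lemma hardy_plus_eq_zero_if_extension_zero:
  assumes "hardy_extension {0<..} p F f" "\<And>z. Im z > 0 \<Longrightarrow> F z = 0"
  shows "AE x in lebesgue. f x = 0"
proof -
  have "AE x in lebesgue. nontangential_limit {z. Im z \<in> {0<..}} F x (f x)"
    using assms(1) by (simp add: hardy_extension_def)
  then show ?thesis
  proof eventually_elim
    fix x assume lim: "nontangential_limit {z. Im z \<in> {0<..}} F x (f x)"
    let ?U = "{z \<in> {z. Im z \<in> {0<..}}. \<bar>Re z - x\<bar> < 1 * \<bar>Im z\<bar>}"
    have "filterlim (\<lambda>t. Complex x t) (at (complex_of_real x) within ?U) (at_right 0)"
      unfolding filterlim_at
    proof
      show "\<forall>\<^sub>F t in at_right 0. Complex x t \<in> ?U \<and> Complex x t \<noteq> complex_of_real x"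
        by (auto simp: eventually_at_filter complex_eq_iff)
      show "(Complex x \<longlongrightarrow> complex_of_real x) (at_right 0)"
        unfolding Complex_eq by (auto intro!: tendsto_eq_intros)
    qed
    moreover have "(F \<longlongrightarrow> f x) (at (complex_of_real x) within ?U)"
      using lim[unfolded nontangential_limit_def, rule_format, of 1] by simp
    ultimately have "((\<lambda>t. F (Complex x t)) \<longlongrightarrow> f x) (at_right 0)"
      by (rule filterlim_compose[rotated])
    moreover have "((\<lambda>t. F (Complex x t)) \<longlongrightarrow> 0) (at_right 0)"
      by (rule tendsto_eventually) (use assms(2) in \<open>auto simp: eventually_at_filter\<close>)
    ultimately show "f x = 0"
      by (rule tendsto_unique[rotated]) simp
  qed
qed

section \<open>Blaschke factors\<close>

text \<open>
  The parameter \<open>a\<close> may lie in either half-plane: replacing \<open>a\<close> by \<open>cnj a\<close> gives the reciprocal,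
  which on the real line is the complex conjugate.
\<close>

definition blaschke_factor :: "complex \<Rightarrow> complex \<Rightarrow> complex" where
  "blaschke_factor a z = (z - a) / (z - cnj a)"

lemma blaschke_factor_inverse:
  assumes "z \<noteq> a" "z \<noteq> cnj a"
  shows "blaschke_factor (cnj a) z * blaschke_factor a z = 1"
  using assms by (simp add: blaschke_factor_def)

lemma cnj_blaschke_factor_of_real:
  "cnj (blaschke_factor a (complex_of_real x)) = blaschke_factor (cnj a) (complex_of_real x)"
  by (simp add: blaschke_factor_def)

lemma of_real_neq_nonreal:
  assumes "Im a \<noteq> 0"
  shows "complex_of_real x \<noteq> a" "complex_of_real x \<noteq> cnj a"
  using assms by (auto simp: complex_eq_iff)

text \<open>
  The hypothesis says that \<open>z\<close> and \<open>a\<close> lie in the same closed half-plane, so that \<open>z\<close> is at least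
  as close to \<open>a\<close> as to its mirror image.
\<close>

lemma norm_blaschke_factor_le_1:
  assumes "0 \<le> Im z * Im a"
  shows "norm (blaschke_factor a z) \<le> 1"
proof -
  have "(norm (z - a))\<^sup>2 \<le> (norm (z - cnj a))\<^sup>2"
    using assms unfolding cmod_power2 by (simp add: power2_eq_square algebra_simps)
  then have "norm (z - a) \<le> norm (z - cnj a)"
    by (simp add: power2_le_iff_abs_le)
  then show ?thesis
    by (auto simp: blaschke_factor_def norm_divide divide_le_eq)
qed

lemma isCont_blaschke_factor: "z \<noteq> cnj a \<Longrightarrow> isCont (blaschke_factor a) z"
  unfolding blaschke_factor_def by (intro continuous_intros) auto

lemma holomorphic_blaschke_factor:
  "cnj a \<notin> S \<Longrightarrow> blaschke_factor a holomorphic_on S"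
  unfolding blaschke_factor_def by (intro holomorphic_intros) auto

lemma hardy_extension_mult_blaschke_factor:
  assumes "hardy_extension Y p F f" "0 < p" and "\<And>y. y \<in> Y \<Longrightarrow> 0 < y * Im a" "Im a \<noteq> 0"
  shows "hardy_extension Y p (\<lambda>z. blaschke_factor a z * F z)
           (\<lambda>x. blaschke_factor a (complex_of_real x) * f x)"
proof (rule hardy_extension_mult[OF assms(1,2), where K = "{}" and C = 1])
  have "cnj a \<notin> {z. Im z \<in> Y}"
    using assms(3)[of "- Im a"] by (auto simp: not_less)
  then show "(\<lambda>z. blaschke_factor a z * F z) holomorphic_on {z. Im z \<in> Y}"
    using assms(1) by (auto simp: hardy_extension_def
        intro!: holomorphic_intros holomorphic_blaschke_factor)
  show "isCont (blaschke_factor a) (complex_of_real x)" for x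
    using assms(4) by (intro isCont_blaschke_factor of_real_neq_nonreal)
qed (use assms(3) assms(3)[of 0] in \<open>auto intro!: norm_blaschke_factor_le_1 simp: less_imp_le\<close>)

lemma hardy_plus_mult_blaschke_factor:
  assumes "f \<in> hardy_plus p" "0 < p" "0 < Im a"
  shows "(\<lambda>x. blaschke_factor a (complex_of_real x) * f x) \<in> hardy_plus p"
  using assms hardy_extension_mult_blaschke_factor[of "{0<..}" p _ f a]
  unfolding hardy_plus_iff by fastforce

lemma hardy_minus_mult_cnj_blaschke_factor:
  assumes "f \<in> hardy_minus p" "0 < p" "0 < Im a"
  shows "(\<lambda>x. blaschke_factor (cnj a) (complex_of_real x) * f x) \<in> hardy_minus p"
  using assms hardy_extension_mult_blaschke_factor[of "{..<0}" p _ f "cnj a"]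
  unfolding hardy_minus_iff by (fastforce simp: mult_less_0_iff)

text \<open>
  Off the disc of radius \<open>Im a / 2\<close> around \<open>a\<close> the reciprocal of a Blaschke factor is at most 5,
  because there \<open>\<bar>z - cnj a\<bar> \<le> \<bar>z - a\<bar> + 2 Im a\<close> and \<open>2 Im a \<le> 4 \<bar>z - a\<bar>\<close>.
\<close>

lemma hardy_extension_divide_blaschke_power:
  assumes ext: "hardy_extension {0<..} p F f" and "0 < p" "0 < Im a"
    and G: "G holomorphic_on {z. Im z > 0}"
    and eq: "\<And>z. Im z > 0 \<Longrightarrow> F z = blaschke_factor a z ^ n * G z"
  shows "hardy_extension {0<..} p G
           (\<lambda>x. blaschke_factor (cnj a) (complex_of_real x) ^ n * f x)"
proof (rule hardy_extension_mult[OF ext \<open>0 < p\<close>,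
      where K = "cball a (Im a / 2)" and C = "5 ^ n" and M = "\<lambda>z. blaschke_factor (cnj a) z ^ n"])
  show "cball a (Im a / 2) \<subseteq> {z. Im z \<in> {0<..}}"
  proof
    fix z assume "z \<in> cball a (Im a / 2)"
    then have "\<bar>Im (a - z)\<bar> \<le> Im a / 2"
      using abs_Im_le_cmod[of "a - z"] by (simp add: dist_norm)
    then have "0 < Im z"
      using \<open>0 < Im a\<close> by (simp only: abs_le_iff minus_complex.sel) linarith
    then show "z \<in> {z. Im z \<in> {0<..}}"
      by simp
  qed
  fix z assume z: "Im z \<in> {0<..}" "z \<notin> cball a (Im a / 2)"
  then have za: "z \<noteq> a" "z \<noteq> cnj a"
    using \<open>0 < Im a\<close> by auto
  show "G z = blaschke_factor (cnj a) z ^ n * F z"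
    using z eq[of z] blaschke_factor_inverse[OF za]
    by (simp add: power_mult_distrib[symmetric] mult.assoc[symmetric])
  have "norm (z - cnj a) \<le> norm (z - a) + norm (a - cnj a)"
    by (metis dist_norm dist_triangle)
  also have "norm (a - cnj a) = 2 * Im a"
    using \<open>0 < Im a\<close> by (simp add: complex_diff_cnj norm_mult)
  also have "norm (z - a) + 2 * Im a \<le> 5 * norm (z - a)"
    using z by (simp add: dist_norm norm_minus_commute)
  finally have "norm (blaschke_factor (cnj a) z) \<le> 5"
    using za by (simp add: blaschke_factor_def norm_divide divide_le_eq)
  then show "norm (blaschke_factor (cnj a) z ^ n) \<le> 5 ^ n"
    by (simp add: norm_power power_mono)
next
  fix x
  have "norm (blaschke_factor (cnj a) (complex_of_real x)) \<le> 5"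
    using norm_blaschke_factor_le_1[of "complex_of_real x" "cnj a"] by simp
  then show "norm (blaschke_factor (cnj a) (complex_of_real x) ^ n) \<le> 5 ^ n"
    by (simp add: norm_power power_mono)
  show "isCont (\<lambda>z. blaschke_factor (cnj a) z ^ n) (complex_of_real x)"
    using \<open>0 < Im a\<close> by (intro isCont_power isCont_blaschke_factor of_real_neq_nonreal) auto
qed (use G in \<open>simp_all add: greaterThan_def\<close>)

lemma holomorphic_divide_blaschke_factor:
  assumes F: "F holomorphic_on {z. Im z > 0}" and "F a = 0" "0 < Im a"
  obtains G where "G holomorphic_on {z. Im z > 0}"
    "\<And>z. Im z > 0 \<Longrightarrow> F z = blaschke_factor a z * G z"
proof -
  let ?D = "\<lambda>z. if z = a then deriv F a else F z / (z - a)"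
  have "?D holomorphic_on {z. Im z > 0}"
    by (rule pole_theorem_open_0[OF F open_upper_half_plane, of a]) (use \<open>F a = 0\<close> in auto)
  then have "(\<lambda>z. (z - cnj a) * ?D z) holomorphic_on {z. Im z > 0}"
    by (intro holomorphic_intros) auto
  moreover have "F z = blaschke_factor a z * ((z - cnj a) * ?D z)" if "Im z > 0" for z
  proof -
    have "z \<noteq> cnj a"
      using that \<open>0 < Im a\<close> by auto
    then show ?thesis
      using \<open>F a = 0\<close> by (auto simp: blaschke_factor_def)
  qed
  ultimately show ?thesis
    using that by blast
qed

text \<open>
  Near \<open>a\<close> the quotient is read off from the local factorization of \<open>F\<close> at its zero, elsewhere it is
  an honest quotient; the two formulas agree on the punctured disc.
\<close>

lemma holomorphic_blaschke_power_factorization: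
  assumes F: "F holomorphic_on {z. Im z > 0}" and nz: "F w \<noteq> 0" "Im w > 0" and a: "0 < Im a"
  obtains n G where "G holomorphic_on {z. Im z > 0}" "G a \<noteq> 0"
    "\<And>z. Im z > 0 \<Longrightarrow> F z = blaschke_factor a z ^ n * G z"
proof (cases "F a = 0")
  case False
  then show ?thesis using that[of F 0] F by simp
next
  case True
  note op = open_upper_half_plane
  have conn: "connected {z. Im z > 0}"
    by (intro convex_connected convex_halfspace_Im_gt)
  have mem: "a \<in> {z. Im z > 0}"
    using a by simp
  have "\<not> F constant_on {z. Im z > 0}"
    using a True nz unfolding constant_on_def by (metis mem_Collect_eq)
  then obtain g r n where g: "0 < r" "ball a r \<subseteq> {z. Im z > 0}" "g holomorphic_on ball a r"
    "\<And>z. z \<in> ball a r \<Longrightarrow> F z = (z - a) ^ n * g z" "\<And>z. z \<in> ball a r \<Longrightarrow> g z \<noteq> 0"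
    using holomorphic_factor_zero_nonconstant[OF F op conn mem True] by metis
  let ?G = "\<lambda>z. if z \<in> ball a r then (z - cnj a) ^ n * g z
                 else blaschke_factor (cnj a) z ^ n * F z"
  have eq: "F z = blaschke_factor a z ^ n * ?G z" if "Im z > 0" for z
  proof -
    have "z \<noteq> cnj a"
      using that a by auto
    moreover have "z \<noteq> a" if "z \<notin> ball a r"
      using that g(1) by auto
    ultimately show ?thesis
      using g(4)[of z]
      by (auto simp: blaschke_factor_def power_divide)
  qed
  have "?G holomorphic_on (ball a r \<union> ({z. Im z > 0} - {a}))"
  proof (rule holomorphic_on_Un)
    show "?G holomorphic_on ball a r"
      by (rule holomorphic_transform[of "\<lambda>z. (z - cnj a) ^ n * g z"])
         (use g(3) in \<open>auto intro!: holomorphic_intros\<close>)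
    show "?G holomorphic_on ({z. Im z > 0} - {a})"
    proof (rule holomorphic_transform[of "\<lambda>z. blaschke_factor (cnj a) z ^ n * F z"])
      show "(\<lambda>z. blaschke_factor (cnj a) z ^ n * F z) holomorphic_on {z. Im z > 0} - {a}"
        using F by (auto intro!: holomorphic_intros holomorphic_blaschke_factor
            intro: holomorphic_on_subset)
      fix z assume z: "z \<in> {z. Im z > 0} - {a}"
      then have "z \<noteq> cnj a"
        using a by auto
      then show "blaschke_factor (cnj a) z ^ n * F z = ?G z"
        using z g(4)[of z] by (auto simp: blaschke_factor_def power_divide)
    qed
  qed (use op in \<open>auto intro: open_delete\<close>)
  moreover have "ball a r \<union> ({z. Im z > 0} - {a}) = {z. Im z > 0}"
    using g(1,2) by auto
  ultimately have "?G holomorphic_on {z. Im z > 0}"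
    by simp
  moreover have "?G a \<noteq> 0"
  proof -
    have "a \<noteq> cnj a"
      using a by (simp add: complex_eq_iff)
    then show ?thesis
      using g(1) g(5)[of a] by simp
  qed
  ultimately show ?thesis
    using eq by (intro that[of ?G n])
qed

section \<open>Maximal functions\<close>

lemma Linf_space_mult:
  assumes "g \<in> Linf_space" "u \<in> borel_measurable lebesgue" "\<And>x. norm (u x) \<le> 1"
  shows "(\<lambda>x. u x * g x) \<in> Linf_space"
proof -
  have [measurable]: "g \<in> borel_measurable lebesgue"
    using assms(1) by (simp add: Linf_space_def)
  obtain C where "AE x in lebesgue. norm (g x) \<le> C"
    using assms(1) by (auto simp: Linf_space_def)
  then have "AE x in lebesgue. norm (u x * g x) \<le> C"
    by eventually_elim
      (simp add: norm_mult order_trans[OF mult_left_le_one_le[OF norm_ge_zero norm_ge_zero assms(3)]])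
  then show ?thesis
    using assms(2) by (auto simp: Linf_space_def)
qed

lemma Linf_space_mult_blaschke_factor:
  assumes "g \<in> Linf_space" "Im a \<noteq> 0"
  shows "(\<lambda>x. blaschke_factor a (complex_of_real x) * g x) \<in> Linf_space"
  using assms by (intro Linf_space_mult measurable_of_isCont_on_reals isCont_blaschke_factor
      of_real_neq_nonreal norm_blaschke_factor_le_1) auto

lemma toeplitz_kernel_add_cmult:
  assumes "f \<in> toeplitz_kernel p g" "h \<in> toeplitz_kernel p g" "0 < p"
  shows "(\<lambda>x. f x + c * h x) \<in> toeplitz_kernel p g"
proof -
  have "(\<lambda>x. f x + c * h x) \<in> hardy_plus p"
    using assms hardy_extension_add hardy_extension_cmult
    by (fastforce simp: toeplitz_kernel_eq hardy_plus_iff)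
  moreover have "(\<lambda>x. g x * f x + c * (g x * h x)) \<in> hardy_minus p"
    using assms hardy_extension_add hardy_extension_cmult
    by (fastforce simp: toeplitz_kernel_eq hardy_minus_iff)
  ultimately show ?thesis
    by (simp add: toeplitz_kernel_eq algebra_simps)
qed

lemma toeplitz_kernel_cmult:
  assumes "f \<in> toeplitz_kernel p g" "0 < p"
  shows "(\<lambda>x. c * f x) \<in> toeplitz_kernel p g"
  using toeplitz_kernel_add_cmult[OF assms(1,1,2), of "c - 1"] by (simp add: algebra_simps)

text \<open>
  Multiplication by the conjugate of a Blaschke factor maps \<open>hardy_minus p\<close> into itself.
\<close>

lemma toeplitz_kernel_mult_cnj_blaschke_factor:
  assumes "f \<in> toeplitz_kernel p g" "0 < p" "0 < Im a"
  shows "f \<in> toeplitz_kernel p (\<lambda>x. blaschke_factor (cnj a) (complex_of_real x) * g x)"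
  using assms hardy_minus_mult_cnj_blaschke_factor[of "\<lambda>x. g x * f x" p a]
  by (simp add: toeplitz_kernel_eq mult.assoc)

lemma blaschke_factor_inverse_of_real:
  assumes "0 < Im a"
  shows "blaschke_factor (cnj a) (complex_of_real x) * (blaschke_factor a (complex_of_real x) * u) = u"
    and "blaschke_factor a (complex_of_real x) * (blaschke_factor (cnj a) (complex_of_real x) * u) = u"
proof -
  have inv: "blaschke_factor (cnj a) (complex_of_real x) * blaschke_factor a (complex_of_real x) = 1"
    using assms by (intro blaschke_factor_inverse of_real_neq_nonreal) simp_all
  show "blaschke_factor (cnj a) (complex_of_real x) * (blaschke_factor a (complex_of_real x) * u) = u"
    by (simp add: mult.assoc[symmetric] inv)
  show "blaschke_factor a (complex_of_real x) * (blaschke_factor (cnj a) (complex_of_real x) * u) = u"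
    by (subst mult.left_commute) (simp add: mult.assoc[symmetric] inv)
qed

text \<open>
  Toeplitz kernels are nearly invariant: dividing out the zero of an element at \<open>a\<close> multiplies its
  image under the symbol by a power of the conjugate Blaschke factor, which keeps it in
  \<open>hardy_minus p\<close>.
\<close>

lemma toeplitz_kernel_nonvanishing_element:
  assumes "\<phi> \<in> toeplitz_kernel p g" "\<not> (AE x in lebesgue. \<phi> x = 0)" "0 < p" "0 < Im a"
  obtains \<psi> \<Psi> where "\<psi> \<in> toeplitz_kernel p g" "hardy_extension {0<..} p \<Psi> \<psi>" "\<Psi> a \<noteq> 0"
proof -
  let ?b' = "\<lambda>x. blaschke_factor (cnj a) (complex_of_real x)"
  obtain \<Phi> where \<Phi>: "hardy_extension {0<..} p \<Phi> \<phi>" and g\<phi>: "(\<lambda>x. g x * \<phi> x) \<in> hardy_minus p"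
    using assms(1) by (auto simp: toeplitz_kernel_eq hardy_plus_iff)
  obtain w where "\<Phi> w \<noteq> 0" "Im w > 0"
    using hardy_plus_eq_zero_if_extension_zero[OF \<Phi>] assms(2) by blast
  moreover have "\<Phi> holomorphic_on {z. Im z > 0}"
    using \<Phi> by (simp add: hardy_extension_def)
  ultimately obtain n G where G: "G holomorphic_on {z. Im z > 0}" "G a \<noteq> 0"
    "\<And>z. Im z > 0 \<Longrightarrow> \<Phi> z = blaschke_factor a z ^ n * G z"
    using holomorphic_blaschke_power_factorization assms(4) by metis
  have ext: "hardy_extension {0<..} p G (\<lambda>x. ?b' x ^ n * \<phi> x)"
    using hardy_extension_divide_blaschke_power[OF \<Phi> assms(3,4) G(1,3)] .
  have "(\<lambda>x. ?b' x ^ n * (g x * \<phi> x)) \<in> hardy_minus p"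
  proof (induction n)
    case (Suc n)
    then show ?case
      using hardy_minus_mult_cnj_blaschke_factor[OF Suc assms(3,4)] by (simp add: mult.assoc)
  qed (use g\<phi> in simp)
  then have "(\<lambda>x. ?b' x ^ n * \<phi> x) \<in> toeplitz_kernel p g"
    using ext by (auto simp: toeplitz_kernel_eq hardy_plus_iff mult.left_commute)
  then show ?thesis
    using that ext G(2) by blast
qed

text \<open>
  The kernel for the new symbol is spanned by \<open>\<psi>\<close>, an element of the old kernel not vanishing at
  \<open>a\<close>, together with the products \<open>b f\<close>, where \<open>f\<close> ranges over the old kernel.  Minimality is
  checked on these two parts separately.
\<close>

lemma maximal_function_mult_blaschke_factor:
  assumes "0 < p" "0 < Im a" "g \<in> Linf_space" "maximal_function p \<phi> (toeplitz_kernel p g)"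
  shows "maximal_function p (\<lambda>x. blaschke_factor a (complex_of_real x) * \<phi> x)
           (toeplitz_kernel p (\<lambda>x. blaschke_factor (cnj a) (complex_of_real x) * g x))"
proof -
  let ?b = "\<lambda>x. blaschke_factor a (complex_of_real x)"
  let ?b' = "\<lambda>x. blaschke_factor (cnj a) (complex_of_real x)"
  note inv = blaschke_factor_inverse_of_real[OF assms(2)]
  have \<phi>: "\<phi> \<in> hardy_plus p" "\<not> (AE x in lebesgue. \<phi> x = 0)" "\<phi> \<in> toeplitz_kernel p g"
    and min: "\<And>k. \<lbrakk>k \<in> Linf_space; \<phi> \<in> toeplitz_kernel p k\<rbrakk>
                \<Longrightarrow> toeplitz_kernel p g \<subseteq> toeplitz_kernel p k"
    using assms(4) by (auto simp: maximal_function_def is_minimal_kernel_def)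
  have g\<phi>: "(\<lambda>x. g x * \<phi> x) \<in> hardy_minus p"
    using \<phi>(3) by (simp add: toeplitz_kernel_eq)
  have b\<phi>: "(\<lambda>x. ?b x * \<phi> x) \<in> hardy_plus p"
    using hardy_plus_mult_blaschke_factor[OF \<phi>(1) assms(1,2)] .
  have bg: "(\<lambda>x. ?b' x * g x) \<in> Linf_space"
    using Linf_space_mult_blaschke_factor[OF assms(3), of "cnj a"] assms(2) by simp
  have mem: "(\<lambda>x. ?b x * \<phi> x) \<in> toeplitz_kernel p (\<lambda>x. ?b' x * g x)"
  proof -
    have "?b' x * g x * (?b x * \<phi> x) = g x * \<phi> x" for x
      using inv(1)[of x "g x * \<phi> x"] by (simp only: ac_simps)
    then show ?thesis
      using b\<phi> g\<phi> by (simp only: toeplitz_kernel_eq mem_Collect_eq simp_thms)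
  qed
  have "\<not> (AE x in lebesgue. ?b x * \<phi> x = 0)"
    using \<phi>(2) inv(1) by (metis (mono_tags, lifting) eventually_mono mult_zero_right)
  moreover obtain \<psi> \<Psi> where \<psi>: "\<psi> \<in> toeplitz_kernel p g"
      and \<Psi>: "hardy_extension {0<..} p \<Psi> \<psi>" "\<Psi> a \<noteq> 0"
    using toeplitz_kernel_nonvanishing_element[OF \<phi>(3,2) assms(1,2)] .
  moreover have "toeplitz_kernel p (\<lambda>x. ?b' x * g x) \<subseteq> toeplitz_kernel p h"
    if h: "h \<in> Linf_space" and bh: "(\<lambda>x. ?b x * \<phi> x) \<in> toeplitz_kernel p h" for h
  proof
    fix f assume f: "f \<in> toeplitz_kernel p (\<lambda>x. ?b' x * g x)"
    have "\<phi> \<in> toeplitz_kernel p (\<lambda>x. ?b x * h x)"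
      using bh \<phi>(1) by (simp add: toeplitz_kernel_eq ac_simps)
    then have sub: "toeplitz_kernel p g \<subseteq> toeplitz_kernel p (\<lambda>x. ?b x * h x)"
      using min[of "\<lambda>x. ?b x * h x"] Linf_space_mult_blaschke_factor[OF h, of a] assms(2) by simp
    \<comment> \<open>Multiplying the symbol \<open>b h\<close> by the conjugate of \<open>b\<close> gives \<open>h\<close>.\<close>
    have \<psi>h: "\<psi> \<in> toeplitz_kernel p h"
      using toeplitz_kernel_mult_cnj_blaschke_factor[OF subsetD[OF sub \<psi>] assms(1,2)]
      by (simp add: inv)
    obtain F where F: "hardy_extension {0<..} p F f"
      using f by (auto simp: toeplitz_kernel_eq hardy_plus_iff)
    \<comment> \<open>The coefficient \<open>t\<close> makes the extension of \<open>f - t \<psi>\<close> vanish at \<open>a\<close>.\<close>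
    define t where "t = F a / \<Psi> a"
    define f0 where "f0 = (\<lambda>x. f x + (- t) * \<psi> x)"
    have f0: "f0 \<in> toeplitz_kernel p (\<lambda>x. ?b' x * g x)"
      unfolding f0_def
      by (intro toeplitz_kernel_add_cmult f assms(1)
          toeplitz_kernel_mult_cnj_blaschke_factor[OF \<psi> assms(1,2)])
    have F0: "hardy_extension {0<..} p (\<lambda>z. F z + (- t) * \<Psi> z) f0"
      unfolding f0_def
      by (intro hardy_extension_add hardy_extension_cmult F \<Psi> assms(1)) simp
    have "(\<lambda>z. F z + (- t) * \<Psi> z) holomorphic_on {z. Im z > 0}"
      using F0 by (simp add: hardy_extension_def greaterThan_def)
    moreover have "F a + (- t) * \<Psi> a = 0"
      using \<Psi>(2) by (simp add: t_def)
    ultimately obtain G where G: "G holomorphic_on {z. Im z > 0}"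
      "\<And>z. Im z > 0 \<Longrightarrow> F z + (- t) * \<Psi> z = blaschke_factor a z * G z"
      using holomorphic_divide_blaschke_factor[where F = "\<lambda>z. F z + (- t) * \<Psi> z"] assms(2)
      by blast
    have "(\<lambda>x. ?b' x * f0 x) \<in> hardy_plus p"
      using hardy_extension_divide_blaschke_power[OF F0 assms(1,2) G(1), of 1] G(2)
      by (auto simp: hardy_plus_iff)
    then have "(\<lambda>x. ?b' x * f0 x) \<in> toeplitz_kernel p g"
      using f0 by (simp add: toeplitz_kernel_eq ac_simps)
    then have "(\<lambda>x. ?b' x * f0 x) \<in> toeplitz_kernel p (\<lambda>x. ?b x * h x)"
      using sub by blast
    moreover have "?b x * h x * (?b' x * f0 x) = h x * f0 x" for x
      using inv(2)[of x "h x * f0 x"] by (simp only: ac_simps)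
    ultimately have "f0 \<in> toeplitz_kernel p h"
      using f0 by (simp only: toeplitz_kernel_eq mem_Collect_eq simp_thms)
    from toeplitz_kernel_add_cmult[OF this \<psi>h assms(1), of t]
    show "f \<in> toeplitz_kernel p h"
      by (simp add: f0_def)
  qed
  ultimately show ?thesis
    using b\<phi> mem bg by (auto simp: maximal_function_def is_minimal_kernel_def T_kernel_def)
qed

text \<open>
  The constant changes neither the kernel nor the symbols whose kernels contain \<open>\<phi>\<close>.
\<close>

lemma maximal_function_mult_unimodular:
  assumes "0 < p" "norm c = 1" "g \<in> Linf_space" "maximal_function p \<phi> (toeplitz_kernel p g)"
  shows "maximal_function p (\<lambda>x. c * \<phi> x) (toeplitz_kernel p (\<lambda>x. cnj c * g x))"
proof -
  have c: "cnj c * (c * u) = u" "c * (cnj c * u) = u" for u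
    using assms(2) complex_norm_square[of c] by (simp_all add: ac_simps)
  have scale: "(\<lambda>x. c * \<phi> x) \<in> toeplitz_kernel p k \<longleftrightarrow> \<phi> \<in> toeplitz_kernel p k" for k
    using toeplitz_kernel_cmult[OF _ assms(1), of \<phi> k c]
      toeplitz_kernel_cmult[OF _ assms(1), of "\<lambda>x. c * \<phi> x" k "cnj c"] by (auto simp: c)
  have minus: "(\<lambda>x. d * u x) \<in> hardy_minus p" if "u \<in> hardy_minus p" for u d
    using that hardy_extension_cmult[OF _ assms(1)] by (fastforce simp: hardy_minus_iff)
  have "toeplitz_kernel p (\<lambda>x. cnj c * g x) = toeplitz_kernel p g"
    using minus[of "\<lambda>x. g x * _ x" "cnj c"] minus[of "\<lambda>x. cnj c * (g x * _ x)" c]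
    by (auto simp: toeplitz_kernel_eq c mult.assoc)
  moreover have "(\<lambda>x. c * \<phi> x) \<in> hardy_plus p"
    using assms(4) scale[of g]
    by (auto simp: maximal_function_def is_minimal_kernel_def toeplitz_kernel_eq)
  moreover have "\<not> (AE x in lebesgue. c * \<phi> x = 0)"
    using assms(2,4) by (auto simp: maximal_function_def)
  ultimately show ?thesis
    using assms(4) by (simp add: maximal_function_def is_minimal_kernel_def scale)
qed

text \<open>
  Each step of the induction over the zeros applies
  \<open>maximal_function_mult_blaschke_factor\<close> to the symbol already modified by the previous zeros,
  which is why boundedness of that symbol is carried along.
\<close>

theorem theorem6p9:
  fixes p :: real and B :: "complex \<Rightarrow> complex" and g \<phi> :: "real \<Rightarrow> complex"
  assumes "1 < p"
    and "finite_blaschke_product B"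
    and "g \<in> Linf_space"
    and "maximal_function p \<phi> (toeplitz_kernel p g)"
  shows "maximal_function p (\<lambda>x. B (complex_of_real x) * \<phi> x)
           (toeplitz_kernel p (\<lambda>x. cnj (B (complex_of_real x)) * g x))"
proof -
  obtain c as where c: "norm c = 1" and as: "\<forall>a \<in> set as. Im a > 0"
    and B: "\<And>z. Im z \<ge> 0 \<Longrightarrow> B z = c * (\<Prod>a\<leftarrow>as. blaschke_factor a z)"
    using assms(2) unfolding finite_blaschke_product_def blaschke_factor_def by blast
  define P where "P as x = c * (\<Prod>a\<leftarrow>as. blaschke_factor a (complex_of_real x))" for as x
  have "(\<lambda>x. cnj (P as x) * g x) \<in> Linf_space \<and>
      maximal_function p (\<lambda>x. P as x * \<phi> x) (toeplitz_kernel p (\<lambda>x. cnj (P as x) * g x))"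
    using as
  proof (induction as)
    case Nil
    then show ?case
      using maximal_function_mult_unimodular[OF _ c assms(3,4)] assms(1)
        Linf_space_mult[OF assms(3), of "\<lambda>_. cnj c"] c by (simp add: P_def)
  next
    case (Cons a as)
    then have IH: "(\<lambda>x. cnj (P as x) * g x) \<in> Linf_space"
      "maximal_function p (\<lambda>x. P as x * \<phi> x) (toeplitz_kernel p (\<lambda>x. cnj (P as x) * g x))"
      and a: "Im a > 0" by auto
    have P: "P (a # as) x = blaschke_factor a (complex_of_real x) * P as x" for x
      by (simp add: P_def)
    show ?case
      using maximal_function_mult_blaschke_factor[OF _ a IH] assms(1) a
        Linf_space_mult_blaschke_factor[OF IH(1), of "cnj a"]
      by (simp add: P cnj_blaschke_factor_of_real mult.assoc)
  qed
  then show ?thesis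
    by (simp add: B P_def)
qed

end
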